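(* Let $p$ be a prime and $K$ a finite extension of $\mathbb{Q}_p$ with maximal ideal $\mathfrak{p}$ of $\mathcal{O}_K$. For each positive integer $n$, there are infinitely many $x_0 \in K$ such that $D_{K,\mathfrak{p}}(x_0)$ has exactly $n$ anti-partial derivatives in $K$.
   Context: $\nu_{\mathfrak{p}}$ is the unique discrete valuation on $K$ extending $\nu_p$. $D_{K,\mathfrak{p}}(x) = x\,\nu_{\mathfrak{p}}(x)/p$ for $x\neq 0$, $D_{K,\mathfrak{p}}(0)=0$. An anti-partial derivative of $y\in K$ is an element $x\in K$ with $D_{K,\mathfrak{p}}(x)=y$. *)

theory Defs
  imports Complex_Main "HOL-Computational_Algebra.Primes"
    "HOL-Algebra.QuotRing" "HOL-Algebra.Embedded_Algebras"
begin

text \<open>The field of p-adic numbers is the completion of the rationals with respect to the p-adic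
  absolute value: p-adic Cauchy sequences of rationals modulo p-adic null sequences.\<close>

definition rat_padic_val :: "nat \<Rightarrow> rat \<Rightarrow> int" where
  "rat_padic_val p r =
     int (multiplicity (int p) (fst (quotient_of r))) - int (multiplicity (int p) (snd (quotient_of r)))"

definition rat_padic_abs :: "nat \<Rightarrow> rat \<Rightarrow> real" where
  "rat_padic_abs p r = (if r = 0 then 0 else real p powi (- rat_padic_val p r))"

definition padic_Cauchy :: "nat \<Rightarrow> (nat \<Rightarrow> rat) \<Rightarrow> bool" where
  "padic_Cauchy p X \<longleftrightarrow>
     (\<forall>\<epsilon>>0. \<exists>N. \<forall>m\<ge>N. \<forall>n\<ge>N. rat_padic_abs p (X m - X n) < \<epsilon>)"

definition padic_null :: "nat \<Rightarrow> (nat \<Rightarrow> rat) \<Rightarrow> bool" where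
  "padic_null p X \<longleftrightarrow> (\<lambda>n. rat_padic_abs p (X n)) \<longlonglongrightarrow> 0"

definition padic_Cauchy_ring :: "nat \<Rightarrow> (nat \<Rightarrow> rat) ring" where
  "padic_Cauchy_ring p =
     \<lparr>carrier = {X. padic_Cauchy p X},
      mult = (\<lambda>X Y n. X n * Y n), one = (\<lambda>_. 1),
      zero = (\<lambda>_. 0), add = (\<lambda>X Y n. X n + Y n)\<rparr>"

definition Qp :: "nat \<Rightarrow> (nat \<Rightarrow> rat) set ring" where
  "Qp p = padic_Cauchy_ring p Quot {X. padic_null p X}"

definition Qp_of_rat :: "nat \<Rightarrow> rat \<Rightarrow> (nat \<Rightarrow> rat) set" where
  "Qp_of_rat p r = {X. padic_null p X} +>\<^bsub>padic_Cauchy_ring p\<^esub> (\<lambda>_. r)"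

text \<open>Along a Cauchy sequence that is not a null sequence the valuation of the terms is eventually
  constant, and the eventual value depends only on the class.  Valuations are only meaningful on
  nonzero elements; the value \<open>\<infinity>\<close> at zero is not represented.\<close>

definition Qp_val :: "nat \<Rightarrow> (nat \<Rightarrow> rat) set \<Rightarrow> int" where
  "Qp_val p a = (THE k. \<forall>X\<in>a. eventually (\<lambda>n. rat_padic_val p (X n) = k) sequentially)"

definition finite_extension_of_Qp ::
  "nat \<Rightarrow> ('a, 'b) ring_scheme \<Rightarrow> ((nat \<Rightarrow> rat) set \<Rightarrow> 'a) \<Rightarrow> bool" where
  "finite_extension_of_Qp p K \<iota> \<longleftrightarrow>
     field K \<and> \<iota> \<in> ring_hom (Qp p) K \<and>
     ring.finite_dimension K (\<iota> ` carrier (Qp p)) (carrier K)"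

text \<open>Values are rational rather than integral: the valuation is normalised by extending the p-adic
  one, so its value group is generated by the inverse of the ramification index.\<close>

definition discrete_valuation :: "('a, 'b) ring_scheme \<Rightarrow> ('a \<Rightarrow> rat) \<Rightarrow> bool" where
  "discrete_valuation K \<nu> \<longleftrightarrow>
     (\<forall>x \<in> carrier K - {\<zero>\<^bsub>K\<^esub>}. \<forall>y \<in> carrier K - {\<zero>\<^bsub>K\<^esub>}. \<nu> (x \<otimes>\<^bsub>K\<^esub> y) = \<nu> x + \<nu> y) \<and>
     (\<forall>x \<in> carrier K - {\<zero>\<^bsub>K\<^esub>}. \<forall>y \<in> carrier K - {\<zero>\<^bsub>K\<^esub>}.
        x \<oplus>\<^bsub>K\<^esub> y \<noteq> \<zero>\<^bsub>K\<^esub> \<longrightarrow> min (\<nu> x) (\<nu> y) \<le> \<nu> (x \<oplus>\<^bsub>K\<^esub> y)) \<and>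
     (\<exists>c>0. \<nu> ` (carrier K - {\<zero>\<^bsub>K\<^esub>}) = range (\<lambda>k::int. of_int k * c))"

definition extends_Qp_val ::
  "nat \<Rightarrow> ('a, 'b) ring_scheme \<Rightarrow> ((nat \<Rightarrow> rat) set \<Rightarrow> 'a) \<Rightarrow> ('a \<Rightarrow> rat) \<Rightarrow> bool" where
  "extends_Qp_val p K \<iota> \<nu> \<longleftrightarrow>
     (\<forall>a \<in> carrier (Qp p) - {\<zero>\<^bsub>Qp p\<^esub>}. \<nu> (\<iota> a) = of_int (Qp_val p a))"

definition valuation_ring :: "('a, 'b) ring_scheme \<Rightarrow> ('a \<Rightarrow> rat) \<Rightarrow> ('a, 'b) ring_scheme" where
  "valuation_ring K \<nu> = K\<lparr>carrier := {x \<in> carrier K. x = \<zero>\<^bsub>K\<^esub> \<or> 0 \<le> \<nu> x}\<rparr>"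

text \<open>The rational factor \<open>\<nu> x / p\<close> is viewed in \<open>K\<close> through the embeddings of the rationals
  into \<open>Qp p\<close> and of \<open>Qp p\<close> into \<open>K\<close>.\<close>

definition partial_derivative ::
  "nat \<Rightarrow> ('a, 'b) ring_scheme \<Rightarrow> ((nat \<Rightarrow> rat) set \<Rightarrow> 'a) \<Rightarrow> ('a \<Rightarrow> rat) \<Rightarrow> 'a \<Rightarrow> 'a" where
  "partial_derivative p K \<iota> \<nu> x =
     (if x = \<zero>\<^bsub>K\<^esub> then \<zero>\<^bsub>K\<^esub> else x \<otimes>\<^bsub>K\<^esub> \<iota> (Qp_of_rat p (\<nu> x / of_nat p)))"

definition anti_partial_derivatives ::
  "nat \<Rightarrow> ('a, 'b) ring_scheme \<Rightarrow> ((nat \<Rightarrow> rat) set \<Rightarrow> 'a) \<Rightarrow> ('a \<Rightarrow> rat) \<Rightarrow> 'a \<Rightarrow> 'a set" where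
  "anti_partial_derivatives p K \<iota> \<nu> y = {x \<in> carrier K. partial_derivative p K \<iota> \<nu> x = y}"

end

theory Submission
  imports Defs "HOL-Computational_Algebra.Squarefree"
begin

text \<open>If \<open>D(x) = D(x\<^sub>0) \<noteq> 0\<close> for some rational \<open>x\<^sub>0\<close>, then \<open>x = x\<^sub>0 \<nu>(x\<^sub>0) / \<nu>(x)\<close> is again rational, because
  \<open>\<nu>\<close> has rational values. So only the \<open>p\<close>-adic valuation \<open>v\<close> on the rationals matters, and taking valuations the
  anti-partial derivatives of \<open>D(x\<^sub>0)\<close> correspond to the solutions \<open>w \<noteq> 0\<close> of
  \<open>w + v(w) = m\<close> with \<open>m = v(x\<^sub>0) + v(v(x\<^sub>0))\<close>, or equivalently to the \<open>k \<noteq> m\<close> with \<open>v(m - k) = k\<close>.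
  Let \<open>a\<^sub>0 = 0\<close> and \<open>a\<^sub>i\<^sub>+\<^sub>1 = a\<^sub>i + p ^ a\<^sub>i\<close>. For \<open>m = a\<^sub>n\<close> the solutions are exactly
  \<open>k = a\<^sub>0, \<dots>, a\<^sub>n\<^sub>-\<^sub>1\<close>, and any rational \<open>x\<^sub>0\<close> of valuation \<open>a\<^sub>n\<close> gives this \<open>m\<close>.\<close>

section \<open>The p-adic valuation and absolute value on the rationals\<close>

text \<open>Cross-multiplying with the reduced fraction gives \<open>a * d = c * b\<close>, and
  multiplicities of a prime add up over products. Later proofs can thus use any representing
  fraction, reduced or not.\<close>

lemma rat_padic_val_divide_int:
  assumes "prime p" "a \<noteq> 0" "b \<noteq> 0"
  shows "rat_padic_val p (of_int a / of_int b)
    = int (multiplicity (int p) a) - int (multiplicity (int p) b)"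
proof -
  obtain c d where cd: "quotient_of (of_int a / of_int b) = (c, d)"
    by (cases "quotient_of (of_int a / of_int b)")
  have d: "d > 0" using quotient_of_denom_pos[OF cd] .
  have eq: "(of_int a / of_int b :: rat) = of_int c / of_int d"
    using quotient_of_div[OF cd] .
  hence c: "c \<noteq> 0" using assms d by auto
  have "(of_int (a * d) :: rat) = of_int (c * b)"
    using eq d assms by (simp add: field_simps)
  hence ad: "a * d = c * b" by (simp only: of_int_eq_iff)
  have pe: "prime_elem (int p)" using assms(1) by simp
  have "multiplicity (int p) a + multiplicity (int p) d = multiplicity (int p) c + multiplicity (int p) b"
    using ad assms c d pe by (metis less_irrefl prime_elem_multiplicity_mult_distrib)
  thus ?thesis by (simp add: rat_padic_val_def cd)
qed

lemma rat_as_int_quotient: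
  fixes r :: rat
  assumes "r \<noteq> 0"
  obtains a b where "a \<noteq> 0" "b \<noteq> 0" "r = of_int a / of_int b"
  using assms quotient_of_div quotient_of_denom_pos
  by (metis div_0 less_irrefl of_int_0 surj_pair)

lemma rat_padic_val_of_int:
  assumes "prime p" "a \<noteq> 0"
  shows "rat_padic_val p (of_int a) = int (multiplicity (int p) a)"
  using rat_padic_val_divide_int[OF assms, of 1] by simp

lemma rat_padic_val_mult:
  assumes "prime p" "r \<noteq> 0" "s \<noteq> 0"
  shows "rat_padic_val p (r * s) = rat_padic_val p r + rat_padic_val p s"
proof -
  obtain a b where ab: "a \<noteq> 0" "b \<noteq> 0" "r = of_int a / of_int b"
    using rat_as_int_quotient[OF assms(2)] .
  obtain c d where cd: "c \<noteq> 0" "d \<noteq> 0" "s = of_int c / of_int d"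
    using rat_as_int_quotient[OF assms(3)] .
  have rs: "r * s = of_int (a * c) / of_int (b * d)" using ab cd by simp
  have pe: "prime_elem (int p)" using assms(1) by simp
  show ?thesis
    unfolding rs using ab cd assms(1) pe
    by (subst rat_padic_val_divide_int)
      (simp_all add: rat_padic_val_divide_int prime_elem_multiplicity_mult_distrib)
qed

lemma rat_padic_val_divide:
  assumes "prime p" "r \<noteq> 0" "s \<noteq> 0"
  shows "rat_padic_val p (r / s) = rat_padic_val p r - rat_padic_val p s"
  using rat_padic_val_mult[of p "r / s" s] assms by simp

lemma rat_padic_val_minus: "rat_padic_val p (- r) = rat_padic_val p r"
  by (cases "quotient_of r") (simp add: rat_padic_val_def rat_uminus_code)

text \<open>Over the common denominator \<open>b * d\<close> only the numerators matter, and a power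
  of \<open>p\<close> dividing both of them divides their sum.\<close>

lemma rat_padic_val_add:
  assumes "prime p" "r \<noteq> 0" "s \<noteq> 0" "r + s \<noteq> 0"
  shows "min (rat_padic_val p r) (rat_padic_val p s) \<le> rat_padic_val p (r + s)"
proof -
  obtain a b where ab: "a \<noteq> 0" "b \<noteq> 0" "r = of_int a / of_int b"
    using rat_as_int_quotient[OF assms(2)] .
  obtain c d where cd: "c \<noteq> 0" "d \<noteq> 0" "s = of_int c / of_int d"
    using rat_as_int_quotient[OF assms(3)] .
  let ?m = "multiplicity (int p)"
  have r: "r = of_int (a * d) / of_int (b * d)" and s: "s = of_int (c * b) / of_int (b * d)"
    using ab cd by (simp_all add: field_simps)
  have rs: "r + s = of_int (a * d + c * b) / of_int (b * d)"
    unfolding r s by (simp add: add_divide_distrib)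
  have ne: "a * d + c * b \<noteq> 0" using assms(4) rs by (metis div_0 of_int_0)
  have nu: "\<not> is_unit (int p)" using assms(1) by auto
  have "int p ^ min (?m (a * d)) (?m (c * b)) dvd a * d + c * b"
    by (intro dvd_add multiplicity_dvd') auto
  hence "min (?m (a * d)) (?m (c * b)) \<le> ?m (a * d + c * b)"
    using ne nu by (intro multiplicity_geI) auto
  moreover have "rat_padic_val p r = int (?m (a * d)) - int (?m (b * d))"
    "rat_padic_val p s = int (?m (c * b)) - int (?m (b * d))"
    "rat_padic_val p (r + s) = int (?m (a * d + c * b)) - int (?m (b * d))"
    unfolding r s rs[unfolded r s] using ab cd ne
    by (auto intro!: rat_padic_val_divide_int assms(1) simp del: of_int_mult of_int_add)
  ultimately show ?thesis by linarith
qed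

section \<open>The ultrametric inequality\<close>

lemma rat_padic_abs_nonneg: "0 \<le> rat_padic_abs p r"
  by (simp add: rat_padic_abs_def)

lemma rat_padic_abs_zero: "rat_padic_abs p 0 = 0"
  by (simp add: rat_padic_abs_def)

lemma rat_padic_abs_minus: "rat_padic_abs p (- r) = rat_padic_abs p r"
  by (simp add: rat_padic_abs_def rat_padic_val_minus)

lemma rat_padic_abs_pos:
  assumes "prime p" "r \<noteq> 0"
  shows "0 < rat_padic_abs p r"
  using assms prime_gt_0_nat by (simp add: rat_padic_abs_def)

lemma rat_padic_abs_mult:
  assumes "prime p"
  shows "rat_padic_abs p (r * s) = rat_padic_abs p r * rat_padic_abs p s"
  using assms prime_gt_0_nat[OF assms]
  by (simp add: rat_padic_abs_def rat_padic_val_mult flip: power_int_add)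

lemma rat_padic_abs_add:
  assumes "prime p"
  shows "rat_padic_abs p (r + s) \<le> max (rat_padic_abs p r) (rat_padic_abs p s)"
\<comment> \<open>The bound on valuations concerns nonzero rationals only; the other cases rest on
  the absolute value of 0 being 0.\<close>
proof (cases "r = 0 \<or> s = 0 \<or> r + s = 0")
  case True
  thus ?thesis by (auto simp: rat_padic_abs_zero rat_padic_abs_nonneg le_max_iff_disj)
next
  case False
  have p: "1 \<le> real p" using prime_ge_1_nat[OF assms] by simp
  have "rat_padic_val p r \<le> rat_padic_val p (r + s) \<or> rat_padic_val p s \<le> rat_padic_val p (r + s)"
    using rat_padic_val_add[of p r s] False assms by (auto simp: min_def split: if_splits)
  thus ?thesis
    using False p by (auto simp: rat_padic_abs_def le_max_iff_disj intro: power_int_increasing)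
qed

lemma rat_padic_abs_diff:
  assumes "prime p"
  shows "rat_padic_abs p (r - s) \<le> max (rat_padic_abs p r) (rat_padic_abs p s)"
  using rat_padic_abs_add[OF assms, of r "- s"] by (simp add: rat_padic_abs_minus)

text \<open>The isosceles triangle principle: writing \<open>r\<close> as \<open>(s + r) - s\<close>
  shows that \<open>s + r\<close> cannot be smaller than \<open>r\<close>, so both have the same
  absolute value, and the exponent of a power of \<open>p > 1\<close> is determined by the
  power.\<close>

lemma rat_padic_val_add_eq:
  assumes "prime p" "rat_padic_abs p s < rat_padic_abs p r"
  shows "rat_padic_val p (s + r) = rat_padic_val p r"
proof -
  have r: "r \<noteq> 0" using assms(2) rat_padic_abs_nonneg[of p s] by (auto simp: rat_padic_abs_zero)
  have "rat_padic_abs p r \<le> max (rat_padic_abs p (s + r)) (rat_padic_abs p s)"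
    using rat_padic_abs_diff[OF assms(1), of "s + r" s] by simp
  hence "rat_padic_abs p (s + r) = rat_padic_abs p r"
    using rat_padic_abs_add[OF assms(1), of s r] assms(2) by linarith
  moreover from this have "s + r \<noteq> 0"
    using rat_padic_abs_pos[OF assms(1) r] by (auto simp: rat_padic_abs_zero)
  moreover have "1 < real p" using prime_gt_1_nat[OF assms(1)] by simp
  ultimately show ?thesis
    using r power_int_strict_increasing[of "- rat_padic_val p r" "- rat_padic_val p (s + r)" "real p"]
      power_int_strict_increasing[of "- rat_padic_val p (s + r)" "- rat_padic_val p r" "real p"]
    by (auto simp: rat_padic_abs_def intro: linorder_cases)
qed

section \<open>The p-adic numbers as a quotient ring\<close>

lemma padic_null_iff:
  "padic_null p X \<longleftrightarrow> (\<forall>e>0. \<exists>N. \<forall>n\<ge>N. rat_padic_abs p (X n) < e)"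
  by (simp add: padic_null_def LIMSEQ_iff abs_of_nonneg[OF rat_padic_abs_nonneg])

lemma padic_null_add:
  assumes "prime p" "padic_null p X" "padic_null p Y"
  shows "padic_null p (\<lambda>n. X n + Y n)"
  unfolding padic_null_iff
proof (intro allI impI)
  fix e :: real assume e: "e > 0"
  obtain M N where "\<forall>n\<ge>M. rat_padic_abs p (X n) < e" "\<forall>n\<ge>N. rat_padic_abs p (Y n) < e"
    using assms e unfolding padic_null_iff by blast
  hence "\<forall>n\<ge>max M N. rat_padic_abs p (X n + Y n) < e"
    using rat_padic_abs_add[OF assms(1)] by (metis (no_types) max.bounded_iff max_less_iff_conj order_le_less_trans)
  thus "\<exists>N. \<forall>n\<ge>N. rat_padic_abs p (X n + Y n) < e" by blast
qed

lemma padic_null_minus: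
  assumes "padic_null p X"
  shows "padic_null p (\<lambda>n. - X n)"
  using assms by (simp add: padic_null_def rat_padic_abs_minus)

lemma padic_null_Cauchy:
  assumes "prime p" "padic_null p X"
  shows "padic_Cauchy p X"
  unfolding padic_Cauchy_def
proof (intro allI impI)
  fix e :: real assume e: "e > 0"
  obtain N where "\<forall>n\<ge>N. rat_padic_abs p (X n) < e"
    using assms e unfolding padic_null_iff by blast
  hence "\<forall>m\<ge>N. \<forall>n\<ge>N. rat_padic_abs p (X m - X n) < e"
    using rat_padic_abs_diff[OF assms(1)] by (meson max_less_iff_conj order_le_less_trans)
  thus "\<exists>N. \<forall>m\<ge>N. \<forall>n\<ge>N. rat_padic_abs p (X m - X n) < e" by blast
qed

lemma padic_Cauchy_const: "padic_Cauchy p (\<lambda>_. r)"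
  by (simp add: padic_Cauchy_def rat_padic_abs_zero)

lemma padic_Cauchy_minus:
  assumes "padic_Cauchy p X"
  shows "padic_Cauchy p (\<lambda>n. - X n)"
proof -
  have "rat_padic_abs p (- X m - - X n) = rat_padic_abs p (X m - X n)" for m n
    using rat_padic_abs_minus[of p "X m - X n"] by simp
  thus ?thesis using assms by (simp only: padic_Cauchy_def)
qed

lemma padic_Cauchy_add:
  assumes "prime p" "padic_Cauchy p X" "padic_Cauchy p Y"
  shows "padic_Cauchy p (\<lambda>n. X n + Y n)"
  unfolding padic_Cauchy_def
proof (intro allI impI)
  fix e :: real assume e: "e > 0"
  obtain M where M: "\<And>m n. m \<ge> M \<Longrightarrow> n \<ge> M \<Longrightarrow> rat_padic_abs p (X m - X n) < e"
    using assms(2) e unfolding padic_Cauchy_def by meson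
  obtain N where N: "\<And>m n. m \<ge> N \<Longrightarrow> n \<ge> N \<Longrightarrow> rat_padic_abs p (Y m - Y n) < e"
    using assms(3) e unfolding padic_Cauchy_def by meson
  have "rat_padic_abs p (X m + Y m - (X n + Y n)) < e" if "m \<ge> max M N" "n \<ge> max M N" for m n
    using rat_padic_abs_add[OF assms(1), of "X m - X n" "Y m - Y n"] M[of m n] N[of m n] that
    by (simp add: algebra_simps)
  thus "\<exists>N. \<forall>m\<ge>N. \<forall>n\<ge>N. rat_padic_abs p (X m + Y m - (X n + Y n)) < e" by blast
qed

text \<open>From some index \<open>N\<close> on, all terms are within distance 1 of
  \<open>X N\<close>. Taking the maximum with 1 keeps the bound positive, so that it can be divided
  by.\<close>

lemma padic_Cauchy_eventually_bounded:
  assumes "prime p" "padic_Cauchy p X"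
  obtains B N where "B > 0" "\<And>n. n \<ge> N \<Longrightarrow> rat_padic_abs p (X n) \<le> B"
proof -
  obtain N where N: "\<And>m n. m \<ge> N \<Longrightarrow> n \<ge> N \<Longrightarrow> rat_padic_abs p (X m - X n) < 1"
    using assms(2) unfolding padic_Cauchy_def by (meson zero_less_one)
  have "rat_padic_abs p (X n) \<le> max 1 (rat_padic_abs p (X N))" if "n \<ge> N" for n
    using rat_padic_abs_add[OF assms(1), of "X n - X N" "X N"] N[of n N] that by simp
  thus ?thesis by (intro that[of "max 1 (rat_padic_abs p (X N))" N]) auto
qed

lemma padic_Cauchy_mult_null:
  assumes "prime p" "padic_Cauchy p X" "padic_null p Y"
  shows "padic_null p (\<lambda>n. X n * Y n)"
  unfolding padic_null_iff
proof (intro allI impI)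
  fix e :: real assume e: "e > 0"
  obtain B M where B: "B > 0" "\<And>n. n \<ge> M \<Longrightarrow> rat_padic_abs p (X n) \<le> B"
    using padic_Cauchy_eventually_bounded[OF assms(1,2)] by blast
  obtain N where N: "\<And>n. n \<ge> N \<Longrightarrow> rat_padic_abs p (Y n) < e / B"
    using assms(3) e B(1) unfolding padic_null_iff by (meson divide_pos_pos)
  have "rat_padic_abs p (X n * Y n) < e" if "n \<ge> max M N" for n
  proof -
    have "rat_padic_abs p (X n * Y n) \<le> B * rat_padic_abs p (Y n)"
      using B(2)[of n] that
      by (simp add: rat_padic_abs_mult[OF assms(1)] mult_right_mono rat_padic_abs_nonneg)
    also have "\<dots> < e" using N[of n] that B(1) by (simp add: field_simps)
    finally show ?thesis .
  qed
  thus "\<exists>N. \<forall>n\<ge>N. rat_padic_abs p (X n * Y n) < e" by blast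
qed

lemma padic_Cauchy_mult:
  assumes "prime p" "padic_Cauchy p X" "padic_Cauchy p Y"
  shows "padic_Cauchy p (\<lambda>n. X n * Y n)"
  unfolding padic_Cauchy_def
proof (intro allI impI)
  fix e :: real assume e: "e > 0"
  obtain B M where B: "B > 0" "\<And>n. n \<ge> M \<Longrightarrow> rat_padic_abs p (X n) \<le> B"
    using padic_Cauchy_eventually_bounded[OF assms(1,2)] by blast
  obtain C N where C: "C > 0" "\<And>n. n \<ge> N \<Longrightarrow> rat_padic_abs p (Y n) \<le> C"
    using padic_Cauchy_eventually_bounded[OF assms(1,3)] by blast
  obtain M' where M': "\<And>m n. m \<ge> M' \<Longrightarrow> n \<ge> M' \<Longrightarrow> rat_padic_abs p (X m - X n) < e / C"
    using assms(2) e C(1) unfolding padic_Cauchy_def by (meson divide_pos_pos)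
  obtain N' where N': "\<And>m n. m \<ge> N' \<Longrightarrow> n \<ge> N' \<Longrightarrow> rat_padic_abs p (Y m - Y n) < e / B"
    using assms(3) e B(1) unfolding padic_Cauchy_def by (meson divide_pos_pos)
  let ?L = "max (max M N) (max M' N')"
  have "rat_padic_abs p (X m * Y m - X n * Y n) < e" if "m \<ge> ?L" "n \<ge> ?L" for m n
  proof -
    have "rat_padic_abs p (X m * (Y m - Y n)) \<le> B * rat_padic_abs p (Y m - Y n)"
      using B(2)[of m] that
      by (simp add: rat_padic_abs_mult[OF assms(1)] mult_right_mono rat_padic_abs_nonneg)
    also have "\<dots> < e" using N'[of m n] that B(1) by (simp add: field_simps)
    finally have 1: "rat_padic_abs p (X m * (Y m - Y n)) < e" .
    have "rat_padic_abs p ((X m - X n) * Y n) \<le> rat_padic_abs p (X m - X n) * C"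
      using C(2)[of n] that
      by (simp add: rat_padic_abs_mult[OF assms(1)] mult_left_mono rat_padic_abs_nonneg)
    also have "\<dots> < e" using M'[of m n] that C(1) by (simp add: field_simps)
    finally have 2: "rat_padic_abs p ((X m - X n) * Y n) < e" .
    \<comment> \<open>Each difference is multiplied by an eventually bounded factor; the tolerances
      \<open>e / B\<close> and \<open>e / C\<close> were chosen to bring both summands below
      \<open>e\<close>.\<close>
    have "X m * Y m - X n * Y n = X m * (Y m - Y n) + (X m - X n) * Y n"
      by (simp add: algebra_simps)
    thus ?thesis
      using rat_padic_abs_add[OF assms(1), of "X m * (Y m - Y n)" "(X m - X n) * Y n"] 1 2 by simp
  qed
  thus "\<exists>N. \<forall>m\<ge>N. \<forall>n\<ge>N. rat_padic_abs p (X m * Y m - X n * Y n) < e" by blast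
qed

section \<open>The ring of Cauchy sequences and the ideal of null sequences\<close>

lemma cring_padic_Cauchy_ring:
  assumes "prime p"
  shows "cring (padic_Cauchy_ring p)"
proof (intro cringI abelian_groupI comm_monoidI)
  fix X assume "X \<in> carrier (padic_Cauchy_ring p)"
  thus "\<exists>Y\<in>carrier (padic_Cauchy_ring p). Y \<oplus>\<^bsub>padic_Cauchy_ring p\<^esub> X = \<zero>\<^bsub>padic_Cauchy_ring p\<^esub>"
    by (intro bexI[of _ "\<lambda>n. - X n"]) (simp_all add: padic_Cauchy_ring_def padic_Cauchy_minus)
qed (auto simp: padic_Cauchy_ring_def padic_Cauchy_const padic_Cauchy_add[OF assms]
      padic_Cauchy_mult[OF assms] algebra_simps)

lemma ideal_padic_null:
  assumes "prime p"
  shows "ideal {X. padic_null p X} (padic_Cauchy_ring p)"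
proof -
  interpret cring "padic_Cauchy_ring p" by (rule cring_padic_Cauchy_ring[OF assms])
  \<comment> \<open>\<open>subgroup\<close> speaks of the inverse in the additive monoid, which is a
    definite description; it has to be identified with pointwise negation first.\<close>
  have inv: "inv\<^bsub>add_monoid (padic_Cauchy_ring p)\<^esub> X = (\<lambda>n. - X n)" if "padic_null p X" for X
  proof -
    have "\<ominus>\<^bsub>padic_Cauchy_ring p\<^esub> X = (\<lambda>n. - X n)"
      using padic_null_Cauchy[OF assms that] padic_Cauchy_minus
      by (intro minus_equality) (auto simp: padic_Cauchy_ring_def)
    thus ?thesis by (simp add: a_inv_def)
  qed
  show ?thesis
  proof (rule idealI)
    show "subgroup {X. padic_null p X} (add_monoid (padic_Cauchy_ring p))"
    proof
      show "{X. padic_null p X} \<subseteq> carrier (add_monoid (padic_Cauchy_ring p))"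
        by (auto simp: padic_Cauchy_ring_def padic_null_Cauchy[OF assms])
      show "\<one>\<^bsub>add_monoid (padic_Cauchy_ring p)\<^esub> \<in> {X. padic_null p X}"
        by (simp add: padic_Cauchy_ring_def padic_null_def rat_padic_abs_zero)
    next
      fix X Y assume "X \<in> {X. padic_null p X}" "Y \<in> {X. padic_null p X}"
      thus "X \<otimes>\<^bsub>add_monoid (padic_Cauchy_ring p)\<^esub> Y \<in> {X. padic_null p X}"
        by (simp add: padic_Cauchy_ring_def padic_null_add[OF assms])
    next
      fix X assume "X \<in> {X. padic_null p X}"
      thus "inv\<^bsub>add_monoid (padic_Cauchy_ring p)\<^esub> X \<in> {X. padic_null p X}"
        by (simp only: mem_Collect_eq inv padic_null_minus)
    qed
  next
    fix X Y
    assume "X \<in> {X. padic_null p X}" "Y \<in> carrier (padic_Cauchy_ring p)"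
    hence "padic_null p (\<lambda>n. Y n * X n)"
      by (intro padic_Cauchy_mult_null[OF assms]) (auto simp: padic_Cauchy_ring_def)
    thus "Y \<otimes>\<^bsub>padic_Cauchy_ring p\<^esub> X \<in> {X. padic_null p X}"
      "X \<otimes>\<^bsub>padic_Cauchy_ring p\<^esub> Y \<in> {X. padic_null p X}"
      by (simp_all add: padic_Cauchy_ring_def mult.commute)
  qed (rule ring_axioms)
qed

section \<open>The rationals inside the p-adic numbers\<close>

lemma mem_Qp_of_rat_iff:
  "X \<in> Qp_of_rat p r \<longleftrightarrow> (\<exists>Y. padic_null p Y \<and> X = (\<lambda>n. Y n + r))"
  by (auto simp: Qp_of_rat_def a_r_coset_def r_coset_def padic_Cauchy_ring_def)

lemma const_mem_Qp_of_rat: "(\<lambda>_. r) \<in> Qp_of_rat p r"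
  unfolding mem_Qp_of_rat_iff by (auto intro!: exI[of _ "\<lambda>_. 0"] simp: padic_null_def rat_padic_abs_zero)

text \<open>Constant sequences carry the arithmetic of the rationals, and the projection onto the
  quotient by the null ideal is a ring homomorphism.\<close>

lemma Qp_of_rat_hom:
  assumes "prime p"
  shows "Qp_of_rat p r \<in> carrier (Qp p)"
    and "Qp_of_rat p (r * s) = Qp_of_rat p r \<otimes>\<^bsub>Qp p\<^esub> Qp_of_rat p s"
    and "Qp_of_rat p (r + s) = Qp_of_rat p r \<oplus>\<^bsub>Qp p\<^esub> Qp_of_rat p s"
    and "Qp_of_rat p 1 = \<one>\<^bsub>Qp p\<^esub>"
proof -
  have c: "(\<lambda>_. t) \<in> carrier (padic_Cauchy_ring p)" for t
    by (simp add: padic_Cauchy_ring_def padic_Cauchy_const)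
  note h = ideal.rcos_ring_hom[OF ideal_padic_null[OF assms], folded Qp_def]
  show "Qp_of_rat p r \<in> carrier (Qp p)"
    unfolding Qp_of_rat_def using ring_hom_closed[OF h c] .
  show "Qp_of_rat p (r * s) = Qp_of_rat p r \<otimes>\<^bsub>Qp p\<^esub> Qp_of_rat p s"
    unfolding Qp_of_rat_def ring_hom_mult[OF h c c, symmetric] by (simp add: padic_Cauchy_ring_def)
  show "Qp_of_rat p (r + s) = Qp_of_rat p r \<oplus>\<^bsub>Qp p\<^esub> Qp_of_rat p s"
    unfolding Qp_of_rat_def ring_hom_add[OF h c c, symmetric] by (simp add: padic_Cauchy_ring_def)
  show "Qp_of_rat p 1 = \<one>\<^bsub>Qp p\<^esub>"
    unfolding Qp_of_rat_def ring_hom_one[OF h, symmetric] by (simp add: padic_Cauchy_ring_def)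
qed

lemma Qp_of_rat_nonzero:
  assumes "prime p" "r \<noteq> 0"
  shows "Qp_of_rat p r \<noteq> \<zero>\<^bsub>Qp p\<^esub>"
proof
  assume "Qp_of_rat p r = \<zero>\<^bsub>Qp p\<^esub>"
  hence "padic_null p (\<lambda>_. r)"
    using const_mem_Qp_of_rat[of r p] by (simp add: Qp_def FactRing_def)
  hence "rat_padic_abs p r = 0" by (simp add: padic_null_def LIMSEQ_const_iff)
  thus False using rat_padic_abs_pos[OF assms] by simp
qed

text \<open>Every representative is \<open>r\<close> plus a null sequence. Once the null terms are
  smaller than \<open>r\<close>, they no longer affect the valuation. The constant representative
  makes the eventual value unique.\<close>

lemma Qp_val_of_rat:
  assumes "prime p" "r \<noteq> 0"
  shows "Qp_val p (Qp_of_rat p r) = rat_padic_val p r"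
  unfolding Qp_val_def
proof (rule the_equality)
  show "\<forall>X\<in>Qp_of_rat p r. \<forall>\<^sub>F n in sequentially. rat_padic_val p (X n) = rat_padic_val p r"
  proof
    fix X assume "X \<in> Qp_of_rat p r"
    then obtain Y where Y: "padic_null p Y" "X = (\<lambda>n. Y n + r)"
      unfolding mem_Qp_of_rat_iff by blast
    have "\<forall>\<^sub>F n in sequentially. rat_padic_abs p (Y n) < rat_padic_abs p r"
      using Y(1) rat_padic_abs_pos[OF assms] unfolding padic_null_def by (rule order_tendstoD(2))
    thus "\<forall>\<^sub>F n in sequentially. rat_padic_val p (X n) = rat_padic_val p r"
      by eventually_elim (simp add: Y(2) rat_padic_val_add_eq[OF assms(1)])
  qed
next
  fix k assume "\<forall>X\<in>Qp_of_rat p r. \<forall>\<^sub>F n in sequentially. rat_padic_val p (X n) = k"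
  from bspec[OF this const_mem_Qp_of_rat] show "k = rat_padic_val p r" by simp
qed

section \<open>The equation \<open>v(m - k) = k\<close>\<close>

text \<open>These are the numbers \<open>a\<^sub>i\<close> of the overview: 0, 1, 1 + p, and so on.
  After \<open>a\<close> comes the least \<open>m > a\<close> with
  \<open>v(m - a) = a\<close>.\<close>

fun hit_seq :: "nat \<Rightarrow> nat \<Rightarrow> nat" where
  "hit_seq p 0 = 0"
| "hit_seq p (Suc n) = hit_seq p n + p ^ hit_seq p n"

lemma strict_mono_hit_seq:
  assumes "p > 0"
  shows "strict_mono (hit_seq p)"
  using assms by (simp add: strict_mono_Suc_iff)

text \<open>The difference is a sum of increments \<open>p ^ a\<^sub>l\<close> with
  \<open>l > i\<close>, and there \<open>a\<^sub>l\<close> is at least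
  \<open>a\<^sub>i + 1\<close>.\<close>

lemma hit_seq_diff_Suc_dvd:
  assumes "p > 0" "Suc i \<le> j"
  shows "int p ^ Suc (hit_seq p i) dvd int (hit_seq p j) - int (hit_seq p (Suc i))"
  using assms(2)
proof (induction j rule: dec_induct)
  case base
  show ?case by simp
next
  case (step j)
  have "hit_seq p i < hit_seq p j"
    using strict_mono_hit_seq[OF assms(1)] step(1) by (simp add: strict_mono_less)
  hence "int p ^ Suc (hit_seq p i) dvd int p ^ hit_seq p j" by (intro le_imp_power_dvd) simp
  from dvd_add[OF step.IH this] show ?case by (simp add: algebra_simps)
qed

text \<open>The first increment is exactly \<open>p ^ a\<^sub>i\<close>, and all later ones are
  divisible by a higher power of \<open>p\<close>. Hence every \<open>a\<^sub>i\<close> with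
  \<open>i < j\<close> solves \<open>v(a\<^sub>j - k) = k\<close>.\<close>

lemma multiplicity_hit_seq_diff:
  assumes "prime p" "i < j"
  shows "multiplicity (int p) (int (hit_seq p j) - int (hit_seq p i)) = hit_seq p i"
proof -
  have p: "p > 0" using assms(1) by (rule prime_gt_0_nat)
  obtain t where t: "int (hit_seq p j) - int (hit_seq p (Suc i)) = int p ^ Suc (hit_seq p i) * t"
    using hit_seq_diff_Suc_dvd[OF p, of i j] assms(2) by (auto elim: dvdE)
  have eq: "int (hit_seq p j) - int (hit_seq p i) = int p ^ hit_seq p i * (1 + int p * t)"
    using t by (simp add: algebra_simps)
  have "\<not> int p dvd 1 + int p * t"
    using assms(1) by (metis dvd_add_left_iff dvd_triv_left not_prime_unit prime_nat_int_transfer)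
  thus ?thesis
    unfolding eq using p by (intro multiplicity_eqI) (auto simp: mult.commute)
qed

text \<open>A solution not among the \<open>a\<^sub>i\<close> with \<open>i < n\<close> would have
  to climb past all of them and exceed \<open>a\<^sub>n\<close>, where no solution exists because
  \<open>p ^ k > k\<close>.\<close>

lemma hit_seq_solutions:
  assumes "prime p" "k \<noteq> hit_seq p n" "multiplicity (int p) (int (hit_seq p n) - int k) = k"
  shows "\<exists>i<n. k = hit_seq p i"
proof (rule ccontr)
  assume neg: "\<not> ?thesis"
  have k: "int p ^ k dvd int (hit_seq p n) - int k"
    using assms(3) multiplicity_dvd by metis
  have "hit_seq p i \<le> k" if "i \<le> n" for i
    using that
  proof (induction i)
    case (Suc i)
    have lt: "hit_seq p i < k" using Suc neg by (metis Suc_le_eq Suc_leD le_neq_implies_less)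
    have "int p ^ hit_seq p i dvd int (hit_seq p n) - int (hit_seq p i)"
      using multiplicity_hit_seq_diff[OF assms(1), of i n] Suc.prems multiplicity_dvd
      by (metis Suc_le_eq)
    moreover have "int p ^ hit_seq p i dvd int (hit_seq p n) - int k"
      using lt k by (meson le_imp_power_dvd dvd_trans less_imp_le)
    \<comment> \<open>Subtracting eliminates \<open>a\<^sub>n\<close>: the positive number
      \<open>k - a\<^sub>i\<close> is a multiple of \<open>p ^ a\<^sub>i\<close>, so
      \<open>k\<close> reaches at least the next term of the sequence.\<close>
    ultimately have "int p ^ hit_seq p i dvd
        (int (hit_seq p n) - int (hit_seq p i)) - (int (hit_seq p n) - int k)"
      by (rule dvd_diff)
    hence "int p ^ hit_seq p i dvd int k - int (hit_seq p i)" by simp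
    hence "int p ^ hit_seq p i \<le> int k - int (hit_seq p i)"
      using lt by (intro zdvd_imp_le) auto
    hence "int (hit_seq p (Suc i)) \<le> int k" by simp
    thus ?case by linarith
  qed simp
  hence lt: "hit_seq p n < k" using assms(2) by (simp add: le_neq_implies_less)
  have "int p ^ k dvd int k - int (hit_seq p n)" using k by (simp add: dvd_diff_commute)
  hence "int p ^ k \<le> int k - int (hit_seq p n)" using lt by (intro zdvd_imp_le) auto
  hence "int (p ^ k) \<le> int k" unfolding of_nat_power by linarith
  moreover have "k < p ^ k" using prime_gt_1_nat[OF assms(1)] by (simp add: power_gt_expt)
  ultimately show False by linarith
qed

text \<open>\<open>S\<close> is the equation \<open>D(s) = D(r)\<close> on rationals with the factor
  \<open>1 / p\<close> cancelled. A solution is determined by its valuation, so it suffices to find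
  the \<open>n\<close> valuations that occur.\<close>

lemma card_rat_val_equation:
  assumes p: "prime p" and n: "n > 0"
    and r: "r \<noteq> 0" "rat_padic_val p r = int (hit_seq p n)"
  defines "S \<equiv> {s. s * of_int (rat_padic_val p s) = r * of_int (rat_padic_val p r)}"
  shows "finite S" "card S = n"
proof -
  define m where "m = int (hit_seq p n)"
  \<comment> \<open>\<open>b i\<close> will be the valuation of the i-th solution, and
    \<open>f i\<close> is what the equation then forces that solution to be.\<close>
  define b where "b i = m - int (hit_seq p i)" for i
  define f :: "nat \<Rightarrow> rat" where "f i = r * of_int m / of_int (b i)" for i
  have mono: "strict_mono (hit_seq p)"
    using p by (intro strict_mono_hit_seq prime_gt_0_nat)
  have b: "b i > 0" if "i < n" for i
    using strict_mono_less[OF mono] that by (simp add: b_def m_def)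
  have m0: "m > 0" using b[OF n] by (simp add: b_def)
  \<comment> \<open>As \<open>a\<^sub>0 = 0\<close>, the number \<open>m\<close> is the difference
    \<open>a\<^sub>n - a\<^sub>0\<close>, whose multiplicity is \<open>a\<^sub>0\<close>.\<close>
  have mm: "multiplicity (int p) m = 0"
    using multiplicity_hit_seq_diff[OF p n] by (simp add: m_def)
  have vf: "rat_padic_val p (f i) = b i" if "i < n" for i
  proof -
    have "multiplicity (int p) (b i) = hit_seq p i"
      using multiplicity_hit_seq_diff[OF p that] by (simp add: b_def m_def)
    thus ?thesis
      using b[OF that] m0 mm r p
      by (simp add: f_def rat_padic_val_divide rat_padic_val_mult rat_padic_val_of_int)
        (simp add: b_def m_def)
  qed
  have inj: "inj_on f {..<n}"
  proof (rule inj_onI)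
    fix i j assume "i \<in> {..<n}" "j \<in> {..<n}" "f i = f j"
    hence "b i = b j" using vf by (metis lessThan_iff)
    thus "i = j" using strict_mono_eq[OF mono] by (simp add: b_def)
  qed
  have "S = f ` {..<n}"
  proof (intro equalityI subsetI)
    fix s assume "s \<in> f ` {..<n}"
    then obtain i where i: "i < n" "s = f i" by blast
    show "s \<in> S" using vf[OF i(1)] b[OF i(1)] r(2) by (simp add: S_def i(2) f_def m_def)
  next
    fix s assume "s \<in> S"
    define v where "v = rat_padic_val p s"
    have eq: "s * of_int v = r * of_int m" using \<open>s \<in> S\<close> r(2) by (simp add: S_def v_def m_def)
    hence nz: "s \<noteq> 0" "v \<noteq> 0" using r(1) m0 by auto
    define k where "k = multiplicity (int p) v"
    \<comment> \<open>Valuations of both sides of \<open>eq\<close> are compared; on the right,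
      \<open>m\<close> contributes nothing beyond the valuation of \<open>r\<close>, being prime to
      \<open>p\<close>.\<close>
    have "v + int k = rat_padic_val p (s * of_int v)"
      using nz by (simp add: rat_padic_val_mult rat_padic_val_of_int p k_def v_def)
    also have "\<dots> = m"
      unfolding eq using r m0 mm
      by (simp add: rat_padic_val_mult rat_padic_val_of_int p flip: m_def)
    finally have v: "v = m - int k" by simp
    have "\<exists>i<n. k = hit_seq p i"
    proof (rule hit_seq_solutions[OF p])
      show "k \<noteq> hit_seq p n" using nz(2) v by (simp add: m_def)
      show "multiplicity (int p) (int (hit_seq p n) - int k) = k"
        using k_def unfolding v m_def by (rule sym)
    qed
    then obtain i where i: "i < n" "v = b i" using v by (auto simp: b_def)
    have "s = f i" using eq nz i(2) by (simp add: f_def field_simps)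
    thus "s \<in> f ` {..<n}" using i(1) by blast
  qed
  thus "finite S" "card S = n" using inj by (simp_all add: card_image)
qed

text \<open>The integers \<open>p ^ k * (1 + p * t)\<close> are distinct for distinct
  \<open>t\<close>, and their second factor is prime to \<open>p\<close>.\<close>

lemma infinite_rat_padic_val_eq:
  assumes "prime p"
  shows "infinite {r. r \<noteq> 0 \<and> rat_padic_val p r = int k}"
proof -
  define g :: "nat \<Rightarrow> int" where "g t = int p ^ k * (1 + int p * int t)" for t
  have p: "p > 0" using assms by (rule prime_gt_0_nat)
  have nd: "\<not> int p dvd 1 + int p * int t" for t
    using assms by (metis dvd_add_left_iff dvd_triv_left not_prime_unit prime_nat_int_transfer)
  have "multiplicity (int p) (g t) = k" for t
    unfolding g_def using p nd[of t] by (intro multiplicity_eqI) (auto simp: mult.commute)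
  moreover have g0: "g t \<noteq> 0" for t
    using p nd[of t] by (auto simp: g_def)
  ultimately have "range (\<lambda>t. of_int (g t)) \<subseteq> {r. r \<noteq> 0 \<and> rat_padic_val p r = int k}"
    by (auto simp: rat_padic_val_of_int[OF assms])
  moreover have "inj (\<lambda>t. of_int (g t) :: rat)"
    using p by (auto simp: inj_def g_def)
  ultimately show ?thesis using range_inj_infinite infinite_super by blast
qed

section \<open>Anti-partial derivatives\<close>

theorem theorem2p14:
  fixes p n :: nat
    and K :: "('a, 'b) ring_scheme"
    and \<iota> :: "(nat \<Rightarrow> rat) set \<Rightarrow> 'a"
    and \<nu> :: "'a \<Rightarrow> rat"
    and P :: "'a set"
  assumes "prime p"
    and "finite_extension_of_Qp p K \<iota>"
    and "discrete_valuation K \<nu>"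
    and "extends_Qp_val p K \<iota> \<nu>"
    and "maximalideal P (valuation_ring K \<nu>)"
    and "n > 0"
  shows "infinite {x\<^sub>0 \<in> carrier K.
           finite (anti_partial_derivatives p K \<iota> \<nu> (partial_derivative p K \<iota> \<nu> x\<^sub>0)) \<and>
           card (anti_partial_derivatives p K \<iota> \<nu> (partial_derivative p K \<iota> \<nu> x\<^sub>0)) = n}"
proof -
  interpret K: field K using assms(2) by (simp add: finite_extension_of_Qp_def)
  have hom: "\<iota> \<in> ring_hom (Qp p) K" using assms(2) by (simp add: finite_extension_of_Qp_def)
  define \<phi> where "\<phi> r = \<iota> (Qp_of_rat p r)" for r
  note Q = Qp_of_rat_hom[OF assms(1)]
  have \<phi>_closed: "\<phi> r \<in> carrier K" for r
    unfolding \<phi>_def using ring_hom_closed[OF hom Q(1)] .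
  have \<phi>_mult: "\<phi> (r * s) = \<phi> r \<otimes>\<^bsub>K\<^esub> \<phi> s" for r s
    unfolding \<phi>_def Q(2) using ring_hom_mult[OF hom Q(1) Q(1)] .
  have \<phi>_add: "\<phi> (r + s) = \<phi> r \<oplus>\<^bsub>K\<^esub> \<phi> s" for r s
    unfolding \<phi>_def Q(3) using ring_hom_add[OF hom Q(1) Q(1)] .
  have \<phi>_1: "\<phi> 1 = \<one>\<^bsub>K\<^esub>"
    unfolding \<phi>_def Q(4) using ring_hom_one[OF hom] .
  have \<phi>_0: "\<phi> 0 = \<zero>\<^bsub>K\<^esub>"
    using \<phi>_add[of 0 0] \<phi>_closed[of 0] K.add.l_cancel_one' by simp
  \<comment> \<open>The element \<open>\<phi> (1 / r)\<close> is an inverse of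
    \<open>\<phi> r\<close>, and 1 differs from 0 in a field.\<close>
  have \<phi>_nz: "\<phi> r \<noteq> \<zero>\<^bsub>K\<^esub>" if "r \<noteq> 0" for r
    using \<phi>_mult[of r "1 / r"] \<phi>_closed \<phi>_1 that by auto
  have \<phi>_inj: "inj \<phi>"
  proof (rule injI)
    fix r s assume eq: "\<phi> r = \<phi> s"
    have "\<phi> r = \<phi> (r - s) \<oplus>\<^bsub>K\<^esub> \<phi> s" using \<phi>_add[of "r - s" s] by simp
    hence "\<phi> (r - s) = \<zero>\<^bsub>K\<^esub>"
      unfolding eq using K.add.r_cancel_one'[OF \<phi>_closed \<phi>_closed] by simp
    thus "r = s" using \<phi>_nz[of "r - s"] by auto
  qed
  have \<nu>_\<phi>: "\<nu> (\<phi> r) = of_int (rat_padic_val p r)" if "r \<noteq> 0" for r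
    using assms(4) Q(1) Qp_of_rat_nonzero[OF assms(1) that] Qp_val_of_rat[OF assms(1) that]
    by (simp add: extends_Qp_val_def \<phi>_def)
  let ?D = "partial_derivative p K \<iota> \<nu>"
  have p0: "(of_nat p :: rat) \<noteq> 0" using prime_gt_0_nat[OF assms(1)] by simp
  have D: "?D x = x \<otimes>\<^bsub>K\<^esub> \<phi> (\<nu> x / of_nat p)" if "x \<noteq> \<zero>\<^bsub>K\<^esub>" for x
    using that by (simp add: partial_derivative_def \<phi>_def)
  have D_\<phi>: "?D (\<phi> r) = \<phi> (r * of_int (rat_padic_val p r) / of_nat p)" for r
  proof (cases "r = 0")
    case True
    thus ?thesis by (simp add: \<phi>_0 partial_derivative_def)
  next
    case False
    thus ?thesis by (simp add: D \<phi>_nz \<nu>_\<phi> flip: \<phi>_mult)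
  qed
  \<comment> \<open>A nonzero valuation of \<open>r\<close> makes the derivative nonzero; the value
    0 is instead taken at every element of valuation 0.\<close>
  have anti: "anti_partial_derivatives p K \<iota> \<nu> (?D (\<phi> r))
      = \<phi> ` {s. s * of_int (rat_padic_val p s) = r * of_int (rat_padic_val p r)}" (is "?A = \<phi> ` ?S")
    if r: "r \<noteq> 0" "rat_padic_val p r \<noteq> 0" for r
  proof (intro equalityI subsetI)
    fix x assume "x \<in> \<phi> ` ?S"
    thus "x \<in> ?A" by (auto simp: anti_partial_derivatives_def \<phi>_closed D_\<phi>)
  next
    fix x assume "x \<in> ?A"
    hence x: "x \<in> carrier K" "?D x = ?D (\<phi> r)" by (auto simp: anti_partial_derivatives_def)
    let ?t = "r * of_int (rat_padic_val p r) / of_nat p"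
    have nz: "\<phi> ?t \<noteq> \<zero>\<^bsub>K\<^esub>" using r p0 by (intro \<phi>_nz) simp
    have x0: "x \<noteq> \<zero>\<^bsub>K\<^esub>" using x nz D_\<phi> by (auto simp: partial_derivative_def)
    have eq: "x \<otimes>\<^bsub>K\<^esub> \<phi> (\<nu> x / of_nat p) = \<phi> ?t" using x D[OF x0] D_\<phi> by simp
    hence \<nu>0: "\<nu> x \<noteq> 0" using nz \<phi>_0 x(1) by auto
    \<comment> \<open>Since \<open>\<nu> x\<close> is rational, the factor multiplying
      \<open>x\<close> can be inverted inside the image of \<open>\<phi>\<close>. This forces
      \<open>x\<close> itself into that image.\<close>
    have "x = x \<otimes>\<^bsub>K\<^esub> \<phi> (\<nu> x / of_nat p * (of_nat p / \<nu> x))"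
      using \<nu>0 p0 x(1) by (simp add: \<phi>_1)
    also have "\<dots> = \<phi> ?t \<otimes>\<^bsub>K\<^esub> \<phi> (of_nat p / \<nu> x)"
      unfolding \<phi>_mult eq[symmetric] using x(1) \<phi>_closed by (simp add: K.m_assoc)
    also have "\<dots> = \<phi> (?t * (of_nat p / \<nu> x))" by (simp only: \<phi>_mult)
    finally obtain s where s: "x = \<phi> s" by blast
    have "s * of_int (rat_padic_val p s) / of_nat p = ?t"
      using x(2) \<phi>_inj unfolding s D_\<phi> by (simp only: inj_eq)
    thus "x \<in> \<phi> ` ?S" using s p0 by simp
  qed
  let ?R = "{r. r \<noteq> 0 \<and> rat_padic_val p r = int (hit_seq p n)}"
  \<comment> \<open>Here \<open>n > 0\<close> enters: \<open>a\<^sub>n\<close> exceeds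
    \<open>a\<^sub>0 = 0\<close>, so the chosen \<open>r\<close> have nonzero valuation.\<close>
  have pos: "hit_seq p n > 0"
    using strict_mono_less[OF strict_mono_hit_seq, of p 0 n] prime_gt_0_nat[OF assms(1)] assms(6) by simp
  have "\<phi> ` ?R \<subseteq> {x\<^sub>0 \<in> carrier K.
      finite (anti_partial_derivatives p K \<iota> \<nu> (?D x\<^sub>0)) \<and>
      card (anti_partial_derivatives p K \<iota> \<nu> (?D x\<^sub>0)) = n}"
  proof (intro subsetI, elim imageE)
    fix x r assume x: "x = \<phi> r" and "r \<in> ?R"
    hence r: "r \<noteq> 0" "rat_padic_val p r = int (hit_seq p n)" by auto
    have r': "rat_padic_val p r \<noteq> 0" using r(2) pos by simp
    show "x \<in> {x\<^sub>0 \<in> carrier K.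
      finite (anti_partial_derivatives p K \<iota> \<nu> (?D x\<^sub>0)) \<and>
      card (anti_partial_derivatives p K \<iota> \<nu> (?D x\<^sub>0)) = n}"
      unfolding x using card_rat_val_equation[OF assms(1,6) r] anti[OF r(1) r'] \<phi>_closed
      by (simp add: card_image inj_on_subset[OF \<phi>_inj])
  qed
  moreover have "infinite (\<phi> ` ?R)"
    using infinite_rat_padic_val_eq[OF assms(1)] \<phi>_inj by (simp add: finite_image_iff inj_on_subset)
  ultimately show ?thesis using infinite_super by blast
qed

end
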